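(* Vertical planes are the only connected minimal surfaces in $\mathcal{H}_3$ whose Gauss map is constant: every vertical plane is a minimal surface with constant Gauss map, and every connected oriented minimal surface in $\mathcal{H}_3$ with constant Gauss map is (an open piece of) a vertical plane.
   Context: The Heisenberg group $\mathcal{H}_3$ is $\mathbb{R}^3$ with the product $(x_1,y_1,z_1)*(x_2,y_2,z_2)=(x_1+x_2,\,y_1+y_2,\,z_1+z_2+\frac{x_1y_2-x_2y_1}{2})$, equipped with the left-invariant Riemannian metric $ds^2=dx^2+dy^2+(\frac12 y\,dx-\frac12 x\,dy+dz)^2$. For $p\in\mathcal{H}_3$ let $L_p$ denote left translation by $p$. For an oriented surface $S\subset\mathcal{H}_3$ with unit normal field $\eta$, the Gauss map is $\gamma:S\to S^2=\{v\in\mathfrak{h}_3:|v|=1\}$, $\gamma(p)=(dL_p)^{-1}(\eta(p))$, where $\mathfrak{h}_3=T_e\mathcal{H}_3$ is the Lie algebra. A surface is minimal if its mean curvature vanishes identically. A vertical plane is a set $\{(x,y,z)\in\mathbb{R}^3: ax+by=c\}$ with $(a,b)\neq(0,0)$. *)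

theory Defs
  imports "HOL-Analysis.Analysis"
begin

section \<open>Smooth maps\<close>

definition partial_deriv :: "'m::finite \<Rightarrow> (real^'m \<Rightarrow> 'b::real_normed_vector) \<Rightarrow> real^'m \<Rightarrow> 'b"
  where "partial_deriv i f x = frechet_derivative f (at x) (axis i 1)"

text \<open>Only meaningful for open \<open>U\<close>.\<close>

primrec Ck_on :: "nat \<Rightarrow> (real^'m) set \<Rightarrow> (real^'m \<Rightarrow> 'b::real_normed_vector) \<Rightarrow> bool" where
  "Ck_on 0 U f \<longleftrightarrow> continuous_on U f"
| "Ck_on (Suc k) U f \<longleftrightarrow> f differentiable_on U \<and> (\<forall>i. Ck_on k U (partial_deriv i f))"

definition smooth_on :: "(real^'m) set \<Rightarrow> (real^'m \<Rightarrow> 'b::real_normed_vector) \<Rightarrow> bool"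
  where "smooth_on U f \<longleftrightarrow> (\<forall>k. Ck_on k U f)"


section \<open>Levi-Civita connection of a Riemannian metric on \<open>\<real>\<^sup>n\<close>\<close>

text \<open>A metric is a function \<open>g\<close> with \<open>g p v w\<close> the inner product of the tangent vectors
  \<open>v\<close>, \<open>w\<close> at \<open>p\<close>; all tangent spaces are identified with \<open>\<real>\<^sup>n\<close>.\<close>

type_synonym 'n metric = "real^'n \<Rightarrow> real^'n \<Rightarrow> real^'n \<Rightarrow> real"

definition metric_matrix :: "'n::finite metric \<Rightarrow> real^'n \<Rightarrow> real^'n^'n"
  where "metric_matrix g p = (\<chi> i j. g p (axis i 1) (axis j 1))"

text \<open>\<open>christoffel g p k i j\<close> is the symbol with upper index \<open>k\<close> and lower indices \<open>i\<close>, \<open>j\<close>.\<close>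

definition christoffel :: "'n::finite metric \<Rightarrow> real^'n \<Rightarrow> 'n \<Rightarrow> 'n \<Rightarrow> 'n \<Rightarrow> real"
  where "christoffel g p k i j =
    (1/2) * (\<Sum>l\<in>UNIV. matrix_inv (metric_matrix g p) $ k $ l *
      (partial_deriv i (\<lambda>q. metric_matrix g q $ j $ l) p
     + partial_deriv j (\<lambda>q. metric_matrix g q $ i $ l) p
     - partial_deriv l (\<lambda>q. metric_matrix g q $ i $ j) p))"

text \<open>Covariant derivative, in the direction of the \<open>i\<close>-th parameter, of a vector field \<open>W\<close>
  along the map \<open>X\<close>.\<close>

definition covariant_deriv ::
    "'n::finite metric \<Rightarrow> (real^'m \<Rightarrow> real^'n) \<Rightarrow> 'm::finite \<Rightarrow> (real^'m \<Rightarrow> real^'n) \<Rightarrow> real^'m \<Rightarrow> real^'n"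
  where "covariant_deriv g X i W u = partial_deriv i W u +
    (\<chi> k. \<Sum>a\<in>UNIV. \<Sum>b\<in>UNIV. christoffel g (X u) k a b * partial_deriv i X u $ a * W u $ b)"


section \<open>Surfaces in a Riemannian \<open>\<real>\<^sup>3\<close>\<close>

definition local_param :: "(real^3) set \<Rightarrow> (real^2) set \<Rightarrow> (real^2 \<Rightarrow> real^3) \<Rightarrow> bool"
  where "local_param S U X \<longleftrightarrow>
    open U \<and> smooth_on U X \<and>
    openin (top_of_set S) (X ` U) \<and> (\<exists>Y. homeomorphism U (X ` U) X Y) \<and>
    (\<forall>u\<in>U. inj (frechet_derivative X (at u)))"

definition surface :: "(real^3) set \<Rightarrow> bool"
  where "surface S \<longleftrightarrow> (\<forall>p\<in>S. \<exists>U X. local_param S U X \<and> p \<in> X ` U)"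

definition tangent_space :: "(real^3) set \<Rightarrow> real^3 \<Rightarrow> (real^3) set"
  where "tangent_space S p =
    {frechet_derivative X (at u) w | U X u w. local_param S U X \<and> u \<in> U \<and> X u = p}"

text \<open>An orientation of \<open>S\<close> is given by a continuous unit normal field; it is then
  automatically smooth. Values of \<open>\<eta>\<close> off \<open>S\<close> are irrelevant.\<close>

definition unit_normal_field :: "3 metric \<Rightarrow> (real^3) set \<Rightarrow> (real^3 \<Rightarrow> real^3) \<Rightarrow> bool"
  where "unit_normal_field g S \<eta> \<longleftrightarrow>
    continuous_on S \<eta> \<and>
    (\<forall>p\<in>S. g p (\<eta> p) (\<eta> p) = 1 \<and> (\<forall>v\<in>tangent_space S p. g p (\<eta> p) v = 0))"

definition first_form :: "3 metric \<Rightarrow> (real^2 \<Rightarrow> real^3) \<Rightarrow> real^2 \<Rightarrow> real^2^2"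
  where "first_form g X u = (\<chi> i j. g (X u) (partial_deriv i X u) (partial_deriv j X u))"

definition second_form ::
    "3 metric \<Rightarrow> (real^3 \<Rightarrow> real^3) \<Rightarrow> (real^2 \<Rightarrow> real^3) \<Rightarrow> real^2 \<Rightarrow> real^2^2"
  where "second_form g \<eta> X u =
    (\<chi> i j. g (X u) (covariant_deriv g X i (partial_deriv j X) u) (\<eta> (X u)))"

text \<open>The mean curvature at the point \<open>X u\<close>, namely half the trace of the shape operator,
  whose matrix in the basis of coordinate vectors is the product below. It does not depend on
  the local parametrization \<open>X\<close>.\<close>

definition mean_curvature ::
    "3 metric \<Rightarrow> (real^3 \<Rightarrow> real^3) \<Rightarrow> (real^2 \<Rightarrow> real^3) \<Rightarrow> real^2 \<Rightarrow> real"
  where "mean_curvature g \<eta> X u =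
    (1/2) * trace (matrix_inv (first_form g X u) ** second_form g \<eta> X u)"

definition minimal :: "3 metric \<Rightarrow> (real^3) set \<Rightarrow> (real^3 \<Rightarrow> real^3) \<Rightarrow> bool"
  where "minimal g S \<eta> \<longleftrightarrow>
    (\<forall>U X. local_param S U X \<longrightarrow> (\<forall>u\<in>U. mean_curvature g \<eta> X u = 0))"


section \<open>The Heisenberg group\<close>

definition heis_mult :: "real^3 \<Rightarrow> real^3 \<Rightarrow> real^3"
  where "heis_mult p q =
    vector [p$1 + q$1, p$2 + q$2, p$3 + q$3 + (p$1 * q$2 - q$1 * p$2) / 2]"

definition heis_form :: "real^3 \<Rightarrow> real^3 \<Rightarrow> real"
  where "heis_form p v = (1/2) * p$2 * v$1 - (1/2) * p$1 * v$2 + v$3"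

definition heis_metric :: "3 metric"
  where "heis_metric p v w = v$1 * w$1 + v$2 * w$2 + heis_form p v * heis_form p w"

text \<open>The identity of the group is \<open>0\<close>, and the Lie algebra is its tangent space there,
  on which \<open>heis_metric 0\<close> is the Euclidean inner product.\<close>

definition gauss_map :: "(real^3 \<Rightarrow> real^3) \<Rightarrow> real^3 \<Rightarrow> real^3"
  where "gauss_map \<eta> p = inv (frechet_derivative (heis_mult p) (at 0)) (\<eta> p)"

definition vertical_plane :: "(real^3) set \<Rightarrow> bool"
  where "vertical_plane P \<longleftrightarrow>
    (\<exists>a b c. (a, b) \<noteq> (0, 0) \<and> P = {p. a * p$1 + b * p$2 = c})"

end

theory Submission
  imports Defs
begin

text \<open>In the left-invariant orthonormal frame \<open>E\<^sub>1, E\<^sub>2, E\<^sub>3\<close>, dual to \<open>dx, dy, \<omega>\<close>, the Gauss map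
  records the components of the normal. If it is a constant \<open>n\<close>, then \<open>n\<^sub>1 dx + n\<^sub>2 dy + n\<^sub>3 \<omega>\<close>
  vanishes on the surface; since \<open>d\<omega> = - dx \<and> dy\<close>, equality of mixed partial derivatives forces
  \<open>n\<^sub>3 = 0\<close>. Hence \<open>n\<^sub>1 x + n\<^sub>2 y\<close> is constant on the connected surface, which is open in the
  resulting vertical plane by invariance of domain. Conversely, for the vertical plane with unit
  normal \<open>N = a E\<^sub>1 + b E\<^sub>2\<close> the second fundamental form in the orthonormal tangent basis
  \<open>T = - b E\<^sub>1 + a E\<^sub>2\<close>, \<open>E\<^sub>3\<close> has zero diagonal and off-diagonal entry \<open>1/2\<close>, so it is trace free.\<close>

section \<open>Partial derivatives, their symmetry, and differentiation of identities\<close>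

section \<open>Derivatives\<close>

lemma has_derivative_partial_deriv:
  assumes "f differentiable at x"
  shows "(f has_derivative (\<lambda>h. \<Sum>i\<in>UNIV. h$i *\<^sub>R partial_deriv i f x)) (at x)"
proof -
  let ?D = "frechet_derivative f (at x)"
  have D: "(f has_derivative ?D) (at x)"
    using assms frechet_derivative_works by blast
  then have "linear ?D"
    by (rule has_derivative_linear)
  have "?D h = (\<Sum>i\<in>UNIV. h$i *\<^sub>R partial_deriv i f x)" for h
  proof -
    have "?D h = ?D (\<Sum>i\<in>UNIV. h$i *\<^sub>R axis i 1)"
      using basis_expansion[of h] by (simp add: scalar_mult_eq_scaleR)
    also have "\<dots> = (\<Sum>i\<in>UNIV. h$i *\<^sub>R partial_deriv i f x)"
      using \<open>linear ?D\<close> by (simp add: linear_sum linear_scale partial_deriv_def)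
    finally show ?thesis .
  qed
  then have "?D = (\<lambda>h. \<Sum>i\<in>UNIV. h$i *\<^sub>R partial_deriv i f x)" ..
  with D show ?thesis by simp
qed

lemma partial_deriv_eqI:
  assumes "(f has_derivative f') (at x)"
  shows "partial_deriv i f x = f' (axis i 1)"
  using frechet_derivative_at[OF assms] by (simp add: partial_deriv_def)

lemma has_real_derivative_along_axis:
  fixes f :: "real^'m \<Rightarrow> real^'n"
  assumes "f differentiable at x"
  shows "((\<lambda>t. f (x + t *\<^sub>R axis i 1) $ k) has_real_derivative partial_deriv i f x $ k) (at 0)"
proof -
  have D: "(f has_derivative frechet_derivative f (at x)) (at x)"
    using assms frechet_derivative_works by blast
  have "((\<lambda>t. x + t *\<^sub>R axis i (1::real)) has_derivative (\<lambda>t. t *\<^sub>R axis i 1)) (at (0::real))"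
    by (auto intro!: derivative_eq_intros)
  from has_derivative_compose[OF this, of f] D
  have "((\<lambda>t. f (x + t *\<^sub>R axis i 1)) has_derivative
          (\<lambda>t. frechet_derivative f (at x) (t *\<^sub>R axis i 1))) (at 0)"
    by simp
  then have "((\<lambda>t. f (x + t *\<^sub>R axis i 1) $ k) has_derivative
          (\<lambda>t. frechet_derivative f (at x) (t *\<^sub>R axis i 1) $ k)) (at 0)"
    by (rule bounded_linear.has_derivative[OF bounded_linear_vec_nth])
  then show ?thesis
    using has_derivative_linear[OF D]
    by (simp add: has_field_derivative_def linear_scale partial_deriv_def mult.commute[of _ "_ $ k"])
qed

lemma smooth_on_imp_Ck_on_2:
  assumes "smooth_on U f"
  shows "f differentiable_on U" "partial_deriv i f differentiable_on U"
    "continuous_on U (partial_deriv i (partial_deriv j f))"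
proof -
  have "Ck_on (Suc (Suc 0)) U f"
    using assms by (auto simp: smooth_on_def)
  then show "f differentiable_on U" "partial_deriv i f differentiable_on U"
      "continuous_on U (partial_deriv i (partial_deriv j f))"
    by auto
qed

lemma smooth_on_differentiable:
  assumes "smooth_on U f" "open U" "x \<in> U"
  shows "f differentiable at x" "partial_deriv i f differentiable at x"
  using smooth_on_imp_Ck_on_2[OF assms(1)] assms(2,3)
  by (auto simp: differentiable_on_eq_differentiable_at)

text \<open>The mean value theorem is applied twice: along \<open>v\<close> to the increment of
  \<open>f\<close> in direction \<open>w\<close>, then along \<open>w\<close> to
  \<open>fv\<close>.\<close>

lemma second_difference_mean_value:
  fixes f fv fvw :: "'a::real_normed_vector \<Rightarrow> real"
  assumes "h > 0"
    and dv: "\<And>y. y \<in> U \<Longrightarrow> ((\<lambda>t. f (y + t *\<^sub>R v)) has_real_derivative fv y) (at 0)"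
    and dw: "\<And>y. y \<in> U \<Longrightarrow> ((\<lambda>t. fv (y + t *\<^sub>R w)) has_real_derivative fvw y) (at 0)"
    and U: "\<And>s t. \<lbrakk>0 \<le> s; s \<le> h; 0 \<le> t; t \<le> h\<rbrakk> \<Longrightarrow> x + s *\<^sub>R v + t *\<^sub>R w \<in> U"
  obtains s t where "0 < s" "s < h" "0 < t" "t < h"
    "f (x + h *\<^sub>R v + h *\<^sub>R w) - f (x + h *\<^sub>R v) - f (x + h *\<^sub>R w) + f x
       = h\<^sup>2 * fvw (x + s *\<^sub>R v + t *\<^sub>R w)"
proof -
  \<comment> \<open>The derivative hypotheses speak of \<open>t = 0\<close> only; moving the base
    point along \<open>z\<close> turns them into derivatives at every \<open>s\<close>.\<close>
  have shift: "((\<lambda>r. g (y + r *\<^sub>R z)) has_real_derivative g' (y + s *\<^sub>R z)) (at s)"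
    if "\<And>y. y \<in> U \<Longrightarrow> ((\<lambda>t. g (y + t *\<^sub>R z)) has_real_derivative g' y) (at 0)"
      "y + s *\<^sub>R z \<in> U" for g g' y z s
    using that(1)[OF that(2)] DERIV_shift[of "\<lambda>r. g (y + r *\<^sub>R z)" "g' (y + s *\<^sub>R z)" 0 s]
    by (simp add: scaleR_add_left add_ac)
  \<comment> \<open>The increment of \<open>p\<close> from \<open>0\<close> to \<open>h\<close> is
    the second difference.\<close>
  define p where "p = (\<lambda>s. f (x + h *\<^sub>R w + s *\<^sub>R v) - f (x + s *\<^sub>R v))"
  have "(p has_real_derivative (fv (x + h *\<^sub>R w + s *\<^sub>R v) - fv (x + s *\<^sub>R v))) (at s)"
    if "0 \<le> s" "s \<le> h" for s
    unfolding p_def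
    using shift[OF dv, of "x + h *\<^sub>R w" s] shift[OF dv, of x s]
      U[of s h] U[of s 0] that \<open>h > 0\<close>
    by (intro DERIV_diff) (simp_all add: add_ac)
  from MVT2[OF \<open>h > 0\<close>, of p, OF this]
  obtain s where s: "0 < s" "s < h"
    and ps: "p h - p 0 = h * (fv (x + h *\<^sub>R w + s *\<^sub>R v) - fv (x + s *\<^sub>R v))"
    by auto
  have "((\<lambda>t. fv (x + s *\<^sub>R v + t *\<^sub>R w)) has_real_derivative fvw (x + s *\<^sub>R v + t *\<^sub>R w)) (at t)"
    if "0 \<le> t" "t \<le> h" for t
    using shift[OF dw, of "x + s *\<^sub>R v" t] U[of s t] that s by simp
  from MVT2[OF \<open>h > 0\<close>, of "\<lambda>t. fv (x + s *\<^sub>R v + t *\<^sub>R w)", OF this]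
  obtain t where t: "0 < t" "t < h"
    and "fv (x + s *\<^sub>R v + h *\<^sub>R w) - fv (x + s *\<^sub>R v) = h * fvw (x + s *\<^sub>R v + t *\<^sub>R w)"
    by auto
  with ps have "p h - p 0 = h * (h * fvw (x + s *\<^sub>R v + t *\<^sub>R w))"
    by (simp add: add_ac)
  then have "f (x + h *\<^sub>R v + h *\<^sub>R w) - f (x + h *\<^sub>R v) - f (x + h *\<^sub>R w) + f x
       = h\<^sup>2 * fvw (x + s *\<^sub>R v + t *\<^sub>R w)"
    by (simp add: p_def power2_eq_square add_ac)
  with s t that show ?thesis by blast
qed

text \<open>The second difference is symmetric in \<open>v\<close> and \<open>w\<close>. For small
  \<open>h\<close> it is therefore \<open>h\<^sup>2\<close> times a value of \<open>fvw\<close> and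
  also \<open>h\<^sup>2\<close> times a value of \<open>fwv\<close>, both taken near
  \<open>x\<close>; continuity carries the equality to \<open>x\<close>.\<close>

lemma mixed_derivatives_eq:
  fixes f fv fw fvw fwv :: "'a::real_normed_vector \<Rightarrow> real"
  assumes "open U" "x \<in> U"
    and "\<And>y. y \<in> U \<Longrightarrow> ((\<lambda>t. f (y + t *\<^sub>R v)) has_real_derivative fv y) (at 0)"
    and "\<And>y. y \<in> U \<Longrightarrow> ((\<lambda>t. f (y + t *\<^sub>R w)) has_real_derivative fw y) (at 0)"
    and "\<And>y. y \<in> U \<Longrightarrow> ((\<lambda>t. fv (y + t *\<^sub>R w)) has_real_derivative fvw y) (at 0)"
    and "\<And>y. y \<in> U \<Longrightarrow> ((\<lambda>t. fw (y + t *\<^sub>R v)) has_real_derivative fwv y) (at 0)"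
    and "continuous_on U fvw" "continuous_on U fwv"
  shows "fvw x = fwv x"
proof (rule ccontr)
  assume ne: "fvw x \<noteq> fwv x"
  \<comment> \<open>Half the gap: a common value within \<open>e\<close> of both
    \<open>fvw x\<close> and \<open>fwv x\<close> would make the gap smaller than itself.\<close>
  define e where "e = \<bar>fvw x - fwv x\<bar> / 2"
  have "e > 0" using ne by (simp add: e_def)
  have cont: "isCont fvw x" "isCont fwv x"
    using assms continuous_on_eq_continuous_at by blast+
  obtain d1 where d1: "d1 > 0" "\<And>y. dist y x < d1 \<Longrightarrow> dist (fvw y) (fvw x) < e"
    using cont(1) \<open>e > 0\<close> unfolding continuous_at_eps_delta by blast
  obtain d2 where d2: "d2 > 0" "\<And>y. dist y x < d2 \<Longrightarrow> dist (fwv y) (fwv x) < e"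
    using cont(2) \<open>e > 0\<close> unfolding continuous_at_eps_delta by blast
  obtain d3 where d3: "d3 > 0" "ball x d3 \<subseteq> U"
    using assms(1,2) open_contains_ball by blast
  define d where "d = min d1 (min d2 d3)"
  \<comment> \<open>Small enough to keep the whole parallelogram with sides
    \<open>h *\<^sub>R v\<close> and \<open>h *\<^sub>R w\<close> within \<open>d\<close> of
    \<open>x\<close>; the summand \<open>1\<close> keeps the denominator positive even when
    \<open>v\<close> and \<open>w\<close> vanish.\<close>
  define h where "h = d / (2 * (norm v + norm w + 1))"
  have "d > 0" using d1 d2 d3 by (simp add: d_def)
  then have "h > 0" unfolding h_def by (intro divide_pos_pos) (auto simp: add_nonneg_pos)
  have dist: "dist (x + s *\<^sub>R v + t *\<^sub>R w) x < d"
    if "0 \<le> s" "s \<le> h" "0 \<le> t" "t \<le> h" for s t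
  proof -
    have "dist (x + s *\<^sub>R v + t *\<^sub>R w) x \<le> s * norm v + t * norm w"
      using that norm_triangle_ineq[of "s *\<^sub>R v" "t *\<^sub>R w"] by (simp add: dist_norm algebra_simps)
    also have "\<dots> \<le> h * norm v + h * norm w"
      using that by (intro add_mono mult_right_mono) auto
    also have "\<dots> < h * (2 * (norm v + norm w + 1))"
    proof -
      have "h * norm v \<ge> 0" "h * norm w \<ge> 0" using \<open>h > 0\<close> by auto
      then have "0 < h * norm v + (h * norm w + h * 2)"
        using \<open>h > 0\<close> by linarith
      then show ?thesis by (simp add: algebra_simps)
    qed
    also have "\<dots> = d"
    proof -
      have "norm v + norm w + 1 > 0"
        by (simp add: add_nonneg_pos)
      then show ?thesis by (simp add: h_def)
    qed
    finally show ?thesis .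
  qed
  have inU: "x + s *\<^sub>R v + t *\<^sub>R w \<in> U"
    if "0 \<le> s" "s \<le> h" "0 \<le> t" "t \<le> h" for s t
    using dist[OF that] d3 by (auto simp: d_def dist_commute subset_eq)
  obtain s t where st: "0 < s" "s < h" "0 < t" "t < h"
    "f (x + h *\<^sub>R v + h *\<^sub>R w) - f (x + h *\<^sub>R v) - f (x + h *\<^sub>R w) + f x
       = h\<^sup>2 * fvw (x + s *\<^sub>R v + t *\<^sub>R w)"
    by (rule second_difference_mean_value[of h U f v fv w fvw x, OF \<open>h > 0\<close> assms(3,5) inU])
  have inU': "x + s *\<^sub>R w + t *\<^sub>R v \<in> U"
    if "0 \<le> s" "s \<le> h" "0 \<le> t" "t \<le> h" for s t
    using inU[of t s] that by (simp add: add_ac)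
  obtain s' t' where st': "0 < s'" "s' < h" "0 < t'" "t' < h"
    "f (x + h *\<^sub>R w + h *\<^sub>R v) - f (x + h *\<^sub>R w) - f (x + h *\<^sub>R v) + f x
       = h\<^sup>2 * fwv (x + s' *\<^sub>R w + t' *\<^sub>R v)"
    by (rule second_difference_mean_value[of h U f w fw v fwv x, OF \<open>h > 0\<close> assms(4,6) inU'])
  have "h\<^sup>2 * fvw (x + s *\<^sub>R v + t *\<^sub>R w) = h\<^sup>2 * fwv (x + t' *\<^sub>R v + s' *\<^sub>R w)"
    using st(5) st'(5) by (simp add: algebra_simps)
  then have eq: "fvw (x + s *\<^sub>R v + t *\<^sub>R w) = fwv (x + t' *\<^sub>R v + s' *\<^sub>R w)"
    using \<open>h > 0\<close> by simp
  have "dist (fvw (x + s *\<^sub>R v + t *\<^sub>R w)) (fvw x) < e"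
    using d1(2) dist[of s t] st by (auto simp: d_def)
  moreover have "dist (fwv (x + t' *\<^sub>R v + s' *\<^sub>R w)) (fwv x) < e"
    using d2(2) dist[of t' s'] st' by (auto simp: d_def)
  ultimately have "\<bar>fvw x - fwv x\<bar> < 2 * e"
    using eq by (simp add: dist_real_def)
  then show False by (simp add: e_def)
qed

lemma partial_deriv_commute:
  fixes f :: "real^'m::finite \<Rightarrow> real^'n"
  assumes "smooth_on U f" "open U" "x \<in> U"
  shows "partial_deriv i (partial_deriv j f) x = partial_deriv j (partial_deriv i f) x"
proof (rule vec_eq_iff[THEN iffD2], rule allI)
  fix k
  show "partial_deriv i (partial_deriv j f) x $ k = partial_deriv j (partial_deriv i f) x $ k"
    by (rule mixed_derivatives_eq[OF assms(2,3), where f = "\<lambda>y. f y $ k"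
          and v = "axis j 1" and w = "axis i 1"
          and fv = "\<lambda>y. partial_deriv j f y $ k" and fw = "\<lambda>y. partial_deriv i f y $ k"])
       (auto intro!: has_real_derivative_along_axis continuous_on_component
          smooth_on_differentiable[OF assms(1,2)] smooth_on_imp_Ck_on_2[OF assms(1)])
qed

lemma Ck_on_const:
  fixes U :: "(real^'m::finite) set"
  shows "Ck_on k U (\<lambda>_. c)"
proof (induction k arbitrary: c)
  case (Suc k)
  have "partial_deriv i (\<lambda>_. c) = (\<lambda>_. 0)" for i :: 'm
    by (rule ext, subst partial_deriv_eqI[OF has_derivative_const]) simp
  with Suc show ?case by simp
qed simp

lemma smooth_on_affine:
  assumes "bounded_linear L"
  shows "smooth_on U (\<lambda>u. L u + c)"
proof -
  have D: "((\<lambda>u. L u + c) has_derivative L) (at x)" for x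
    using bounded_linear_imp_has_derivative[OF assms] by (auto intro!: derivative_eq_intros)
  have P: "partial_deriv i (\<lambda>u. L u + c) = (\<lambda>_. L (axis i 1))" for i
    by (rule ext, subst partial_deriv_eqI[OF D]) simp
  have "(\<lambda>u. L u + c) differentiable_on U"
    using D by (meson differentiableI differentiable_at_imp_differentiable_on)
  moreover from this have "continuous_on U (\<lambda>u. L u + c)"
    by (rule differentiable_imp_continuous_on)
  \<comment> \<open>The first partial derivatives are constants, so a case split on \<open>k\<close>
    replaces induction.\<close>
  ultimately have "Ck_on k U (\<lambda>u. L u + c)" for k
    by (cases k) (auto simp: P Ck_on_const)
  then show ?thesis by (simp add: smooth_on_def)
qed

text \<open>Serves to differentiate an identity that holds on a parameter domain: \<open>G\<close>
  vanishes on the line through \<open>u\<close> for all small \<open>t\<close>, and derivatives are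
  unique.\<close>

lemma derivative_zero_of_zero_on_open:
  fixes G :: "'a::real_normed_vector \<Rightarrow> real"
  assumes "open U" "u \<in> U" "\<And>y. y \<in> U \<Longrightarrow> G y = 0"
    and "((\<lambda>t. G (u + t *\<^sub>R e)) has_real_derivative D) (at 0)"
  shows "D = 0"
proof -
  have "((\<lambda>t. u + t *\<^sub>R e) \<longlongrightarrow> u + 0 *\<^sub>R e) (at (0::real))"
    by (intro tendsto_intros)
  then have "\<forall>\<^sub>F t in at (0::real). u + t *\<^sub>R e \<in> U"
    using topological_tendstoD[OF _ \<open>open U\<close>] \<open>u \<in> U\<close> by simp
  then have "\<forall>\<^sub>F t in at (0::real). G (u + t *\<^sub>R e) = 0"
    by eventually_elim (use assms(3) in simp)
  then have "\<forall>\<^sub>F t in nhds (0::real). G (u + t *\<^sub>R e) = 0"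
    using assms(2,3) by (simp add: eventually_nhds_conv_at)
  then have "((\<lambda>t. 0) has_real_derivative D) (at (0::real))"
    using assms(4) DERIV_cong_ev[of "0::real" 0 "\<lambda>t. G (u + t *\<^sub>R e)" "\<lambda>t. 0" D D]
    by simp
  then show ?thesis
    using DERIV_unique DERIV_const by blast
qed

section \<open>Charts: coordinate vectors, linear functions, open images\<close>

section \<open>Parametrized surfaces\<close>

lemma local_paramD:
  assumes "local_param S U X"
  shows "open U" "smooth_on U X" "openin (top_of_set S) (X ` U)" "X ` U \<subseteq> S"
proof -
  show "open U" "smooth_on U X" "openin (top_of_set S) (X ` U)"
    using assms by (simp_all add: local_param_def)
  then show "X ` U \<subseteq> S" by (blast dest: openin_imp_subset)
qed

lemma partial_deriv_in_tangent_space: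
  assumes "local_param S U X" "u \<in> U"
  shows "partial_deriv i X u \<in> tangent_space S (X u)"
  using assms unfolding tangent_space_def partial_deriv_def by blast

lemma frechet_derivative_local_param:
  assumes "local_param S U X" "u \<in> U"
  shows "frechet_derivative X (at u) h
    = h$1 *\<^sub>R partial_deriv 1 X u + h$2 *\<^sub>R partial_deriv 2 X u"
proof -
  have "X differentiable at u"
    using smooth_on_differentiable local_paramD assms by blast
  note D = frechet_derivative_at[OF has_derivative_partial_deriv[OF this], symmetric]
  show ?thesis unfolding D by (simp add: sum_2)
qed

text \<open>The combination is the differential of \<open>X\<close> at \<open>vector [s, t]\<close>,
  and that differential is injective.\<close>

lemma partial_derivs_independent:
  assumes "local_param S U X" "u \<in> U"
    and "s *\<^sub>R partial_deriv 1 X u + t *\<^sub>R partial_deriv 2 X u = 0"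
  shows "s = 0 \<and> t = 0"
proof -
  note D = frechet_derivative_local_param[OF assms(1,2)]
  have "inj (frechet_derivative X (at u))"
    using assms(1,2) by (simp add: local_param_def)
  moreover have "frechet_derivative X (at u) (vector [s, t]) = frechet_derivative X (at u) 0"
    using assms(3) by (simp add: D)
  ultimately have "(vector [s, t] :: real^2) = 0"
    by (simp add: inj_eq)
  then show ?thesis
    by (simp add: vec_eq_iff forall_2)
qed

text \<open>On a ball around \<open>u\<close> the function \<open>l \<circ> X\<close> has zero
  derivative, so it is constant there by convexity. The image of the ball is open in
  \<open>S\<close> because \<open>X\<close> is a homeomorphism onto an open subset of
  \<open>S\<close>.\<close>

lemma local_param_locally_constant:
  fixes l :: "real^3 \<Rightarrow> real"
  assumes "local_param S U X" "u \<in> U" "bounded_linear l"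
    and "\<And>y i. y \<in> U \<Longrightarrow> l (partial_deriv i X y) = 0"
  shows "\<exists>T. openin (top_of_set S) T \<and> X u \<in> T \<and> (\<forall>q\<in>T. l q = l (X u))"
proof -
  interpret l: bounded_linear l by fact
  obtain r where r: "r > 0" "ball u r \<subseteq> U"
    using local_paramD(1)[OF assms(1)] assms(2) open_contains_ball by blast
  have "((\<lambda>y. l (X y)) has_derivative (\<lambda>h. 0)) (at y within ball u r)" if "y \<in> ball u r" for y
  proof -
    have y: "y \<in> U" using that r by blast
    then have "X differentiable at y"
      using smooth_on_differentiable local_paramD assms(1) by blast
    from l.has_derivative[OF has_derivative_partial_deriv[OF this]]
    have "((\<lambda>y. l (X y)) has_derivative (\<lambda>h. 0)) (at y)"
      using assms(4)[OF y] by (simp add: l.sum l.scaleR)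
    then show ?thesis by (rule has_derivative_at_withinI)
  qed
  from has_derivative_zero_constant[OF convex_ball this]
  obtain c where c: "\<And>y. y \<in> ball u r \<Longrightarrow> l (X y) = c"
    by blast
  obtain Y where "homeomorphism U (X ` U) X Y"
    using assms(1) by (auto simp: local_param_def)
  moreover have "openin (top_of_set U) (ball u r)"
    using r local_paramD(1)[OF assms(1)] by (simp add: openin_open_eq)
  ultimately have "openin (top_of_set (X ` U)) (X ` ball u r)"
    by (rule homeomorphism_imp_open_map)
  then have "openin (top_of_set S) (X ` ball u r)"
    using openin_trans local_paramD(3)[OF assms(1)] by blast
  moreover have "X u \<in> X ` ball u r" "\<forall>q\<in>X ` ball u r. l q = l (X u)"
    using c r by auto
  ultimately show ?thesis by blast
qed

text \<open>Invariance of domain: \<open>X\<close> is continuous and injective on an open subset of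
  the plane, and the hyperplane has dimension 2 since \<open>v \<noteq> 0\<close>.\<close>

lemma local_param_openin_hyperplane:
  fixes v :: "real^3"
  assumes "local_param S U X" "v \<noteq> 0" "S \<subseteq> {p. v \<bullet> p = c}"
  shows "openin (top_of_set {p. v \<bullet> p = c}) (X ` U)"
proof -
  obtain Y where Y: "homeomorphism U (X ` U) X Y"
    using assms(1) by (auto simp: local_param_def)
  show ?thesis
  proof (rule invariance_of_domain_affine_sets)
    show "openin (top_of_set UNIV) U"
      using local_paramD(1)[OF assms(1)] by simp
    show "affine {p. v \<bullet> p = c}"
      by (rule affine_hyperplane)
    show "aff_dim {p. v \<bullet> p = c} \<le> aff_dim (UNIV :: (real^2) set)"
      using assms(2) by simp
    show "continuous_on U X" "inj_on X U"
      using Y by (auto simp: homeomorphism_def inj_on_def) metis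
    show "X \<in> U \<rightarrow> {p. v \<bullet> p = c}"
      using local_paramD(4)[OF assms(1)] assms(3) by blast
  qed auto
qed

section \<open>From a constant Gauss map to a vertical plane\<close>

section \<open>Constant Gauss maps in the Heisenberg group\<close>

text \<open>Left translation by \<open>p\<close> is the affine map taking \<open>q\<close> to
  \<open>p + L q\<close>, so its differential at \<open>0\<close> is \<open>L\<close>. The value is
  found by exhibiting a preimage of \<open>\<eta> p\<close> under the injective
  \<open>L\<close>.\<close>

lemma gauss_map_eq: "gauss_map \<eta> p = vector [\<eta> p $ 1, \<eta> p $ 2, heis_form p (\<eta> p)]"
proof -
  define L :: "real^3 \<Rightarrow> real^3"
    where "L = (\<lambda>v. vector [v$1, v$2, v$3 + (p$1 * v$2 - v$1 * p$2) / 2])"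
  have "linear L"
    by (rule linearI) (auto simp: L_def vec_eq_iff forall_3 field_simps)
  then have "bounded_linear L"
    by (simp add: linear_conv_bounded_linear)
  then have "((\<lambda>q. p + L q) has_derivative L) (at 0)"
    by (auto intro!: derivative_eq_intros bounded_linear_imp_has_derivative)
  moreover have "heis_mult p = (\<lambda>q. p + L q)"
    by (auto simp: heis_mult_def L_def vec_eq_iff forall_3)
  ultimately have D: "frechet_derivative (heis_mult p) (at 0) = L"
    using frechet_derivative_at by metis
  have "inj L"
    by (auto simp: inj_def L_def vec_eq_iff forall_3)
  moreover have "L (vector [\<eta> p $ 1, \<eta> p $ 2, heis_form p (\<eta> p)]) = \<eta> p"
    by (auto simp: L_def heis_form_def vec_eq_iff forall_3 field_simps)
  ultimately show ?thesis
    unfolding gauss_map_def D by (rule inv_f_eq)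
qed

text \<open>Frobenius: the form
  \<open>\<theta> = n\<^sub>1 dx + n\<^sub>2 dy + n\<^sub>3 \<omega>\<close> satisfies \<open>\<theta> \<and> d\<theta> = - n\<^sub>3\<^sup>2 dx \<and> dy \<and> dz\<close>.\<close>

lemma constant_normal_horizontal:
  assumes X: "local_param S U X" "u \<in> U"
    and tangent: "\<And>y i. y \<in> U \<Longrightarrow>
      n1 * partial_deriv i X y $ 1 + n2 * partial_deriv i X y $ 2
        + n3 * heis_form (X y) (partial_deriv i X y) = 0"
  shows "n3 = 0"
proof (rule ccontr)
  assume "n3 \<noteq> 0"
  note U = local_paramD(1,2)[OF X(1)]
  \<comment> \<open>The tangency relation for \<open>partial_deriv i X\<close> is differentiated in
    direction \<open>j\<close>. The antisymmetric term comes from the coefficients of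
    \<open>heis_form\<close>, which vary with the base point.\<close>
  have second: "n1 * W $ 1 + n2 * W $ 2 + n3 * (heis_form (X u) W
        + (partial_deriv j X u $ 2 * partial_deriv i X u $ 1
         - partial_deriv j X u $ 1 * partial_deriv i X u $ 2) / 2) = 0"
    if W: "W = partial_deriv j (partial_deriv i X) u" for i j W
  proof (rule derivative_zero_of_zero_on_open[OF U(1) X(2) tangent])
    have XD: "((\<lambda>t. X (u + t *\<^sub>R axis j 1) $ k) has_real_derivative partial_deriv j X u $ k) (at 0)"
      and XiD: "((\<lambda>t. partial_deriv i X (u + t *\<^sub>R axis j 1) $ k) has_real_derivative W $ k) (at 0)" for k
      unfolding W
      by (intro has_real_derivative_along_axis smooth_on_differentiable[OF U(2,1) X(2)])+
    show "((\<lambda>t. n1 * partial_deriv i X (u + t *\<^sub>R axis j 1) $ 1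
          + n2 * partial_deriv i X (u + t *\<^sub>R axis j 1) $ 2
          + n3 * heis_form (X (u + t *\<^sub>R axis j 1)) (partial_deriv i X (u + t *\<^sub>R axis j 1)))
        has_real_derivative n1 * W $ 1 + n2 * W $ 2 + n3 * (heis_form (X u) W
        + (partial_deriv j X u $ 2 * partial_deriv i X u $ 1
         - partial_deriv j X u $ 1 * partial_deriv i X u $ 2) / 2)) (at 0)"
      unfolding heis_form_def
      by (rule derivative_eq_intros XD XiD refl)+ (simp add: field_simps)
  qed
  define V1 V2 where "V1 = partial_deriv 1 X u" and "V2 = partial_deriv 2 X u"
  \<comment> \<open>Exchanging the two directions leaves \<open>W\<close> unchanged and flips the
    antisymmetric term; subtracting the two identities isolates \<open>dx \<and> dy\<close> on the
    tangent vectors.\<close>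
  have "n3 * (V1 $ 1 * V2 $ 2 - V1 $ 2 * V2 $ 1) = 0"
  proof -
    define W where "W = partial_deriv 1 (partial_deriv 2 X) u"
    have "n1 * W $ 1 + n2 * W $ 2 + n3 * (heis_form (X u) W
        + (V1 $ 2 * V2 $ 1 - V1 $ 1 * V2 $ 2) / 2) = 0"
      using second[OF W_def] by (simp add: V1_def V2_def)
    moreover have "n1 * W $ 1 + n2 * W $ 2 + n3 * (heis_form (X u) W
        + (V2 $ 2 * V1 $ 1 - V2 $ 1 * V1 $ 2) / 2) = 0"
      using second[of W 2 1] partial_deriv_commute[OF U(2,1) X(2)] by (simp add: V1_def V2_def W_def)
    moreover have "n3 * (V1 $ 1 * V2 $ 2 - V1 $ 2 * V2 $ 1) =
      (n1 * W $ 1 + n2 * W $ 2 + n3 * (heis_form (X u) W + (V2 $ 2 * V1 $ 1 - V2 $ 1 * V1 $ 2) / 2))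
      - (n1 * W $ 1 + n2 * W $ 2 + n3 * (heis_form (X u) W + (V1 $ 2 * V2 $ 1 - V1 $ 1 * V2 $ 2) / 2))"
      by (simp add: field_simps)
    ultimately show ?thesis by simp
  qed
  then have det: "V1 $ 1 * V2 $ 2 = V1 $ 2 * V2 $ 1"
    using \<open>n3 \<noteq> 0\<close> by simp
  \<comment> \<open>As \<open>n3\<close> is nonzero, tangency determines the third coordinate of a
    tangent vector from the first two.\<close>
  have zero: "s *\<^sub>R V1 + t *\<^sub>R V2 = 0"
    if "s * V1 $ 1 + t * V2 $ 1 = 0" "s * V1 $ 2 + t * V2 $ 2 = 0" for s t
  proof -
    have "n3 * (s * V1 $ 3 + t * V2 $ 3)
      = s * (n1 * V1 $ 1 + n2 * V1 $ 2 + n3 * heis_form (X u) V1)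
        + t * (n1 * V2 $ 1 + n2 * V2 $ 2 + n3 * heis_form (X u) V2)
        - (n1 + n3 * X u $ 2 / 2) * (s * V1 $ 1 + t * V2 $ 1)
        - (n2 - n3 * X u $ 1 / 2) * (s * V1 $ 2 + t * V2 $ 2)"
      by (simp add: heis_form_def field_simps)
    also have "\<dots> = 0"
      using tangent[OF X(2)] that by (simp add: V1_def V2_def)
    finally have "n3 * (s * V1 $ 3 + t * V2 $ 3) = 0" .
    with \<open>n3 \<noteq> 0\<close> that show ?thesis
      by (simp add: vec_eq_iff forall_3)
  qed
  have indep: "s = 0 \<and> t = 0"
    if "s * V1 $ 1 + t * V2 $ 1 = 0" "s * V1 $ 2 + t * V2 $ 2 = 0" for s t
    using partial_derivs_independent[OF X] zero[OF that] by (simp add: V1_def V2_def)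
  \<comment> \<open>The coefficients \<open>V2 $ 1\<close> and \<open>- V1 $ 1\<close> solve the
    first equation identically and the second by \<open>det\<close>; below, \<open>V2 $ 2\<close>
    and \<open>- V1 $ 2\<close> do so with the roles exchanged. Both projections then vanish, which
    contradicts independence.\<close>
  have "V2 $ 1 = 0 \<and> - V1 $ 1 = 0"
    using det by (intro indep) (auto simp: algebra_simps)
  moreover have "V2 $ 2 = 0 \<and> - V1 $ 2 = 0"
    using det by (intro indep) (auto simp: algebra_simps)
  ultimately show False
    using indep[of 1 0] by simp
qed

lemma constant_gauss_map_vertical_plane:
  assumes S: "surface S" "connected S" and \<eta>: "unit_normal_field heis_metric S \<eta>"
    and const: "gauss_map \<eta> constant_on S"
  shows "\<exists>P. vertical_plane P \<and> openin (top_of_set P) S"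
proof (cases "S = {}")
  \<comment> \<open>The empty set is open in every plane; the plane \<open>x = 0\<close> serves as
    witness.\<close>
  case True
  have "vertical_plane {p. 1 * p$1 + 0 * p$2 = 0}"
    unfolding vertical_plane_def by (rule exI[of _ 1], rule exI[of _ 0], rule exI[of _ 0]) simp
  with True show ?thesis by auto
next
  case False
  then obtain p0 where "p0 \<in> S" by blast
  obtain n where n: "\<And>p. p \<in> S \<Longrightarrow> gauss_map \<eta> p = n"
    using const by (auto simp: constant_on_def)
  have comp: "\<eta> p $ 1 = n $ 1" "\<eta> p $ 2 = n $ 2" "heis_form p (\<eta> p) = n $ 3" if "p \<in> S" for p
    using n[OF that] by (auto simp: gauss_map_eq)
  have tangent: "n $ 1 * partial_deriv i X y $ 1 + n $ 2 * partial_deriv i X y $ 2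
        + n $ 3 * heis_form (X y) (partial_deriv i X y) = 0"
    if "local_param S U X" "y \<in> U" for U X y i
  proof -
    have "X y \<in> S" using local_paramD(4)[OF that(1)] that(2) by blast
    then show ?thesis
      using \<eta> partial_deriv_in_tangent_space[OF that, of i] comp[OF \<open>X y \<in> S\<close>]
      by (auto simp: unit_normal_field_def heis_metric_def)
  qed
  obtain U0 X0 u0 where "local_param S U0 X0" "u0 \<in> U0"
    using S(1) \<open>p0 \<in> S\<close> unfolding surface_def by blast
  from constant_normal_horizontal[OF this tangent[OF this(1)]]
  have n3: "n $ 3 = 0" .
  \<comment> \<open>With the third frame component zero, unit length leaves a nonzero horizontal
    part.\<close>
  moreover have "heis_metric p0 (\<eta> p0) (\<eta> p0) = 1"
    using \<eta> \<open>p0 \<in> S\<close> by (simp add: unit_normal_field_def)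
  ultimately have n12: "(n $ 1, n $ 2) \<noteq> (0, 0)"
    using comp[OF \<open>p0 \<in> S\<close>] by (auto simp: heis_metric_def)
  have inner_n: "n \<bullet> p = n $ 1 * p $ 1 + n $ 2 * p $ 2" for p
    using n3 by (simp add: inner_vec_def sum_3)
  have "(\<lambda>p. n \<bullet> p) constant_on S"
  proof (rule locally_constant_imp_constant[OF S(2)])
    fix p assume "p \<in> S"
    then obtain U X u where X: "local_param S U X" "u \<in> U" "p = X u"
      using S(1) unfolding surface_def by blast
    show "\<exists>T. openin (top_of_set S) T \<and> p \<in> T \<and> (\<forall>x\<in>T. n \<bullet> x = n \<bullet> p)"
      unfolding X(3)
    proof (rule local_param_locally_constant[OF X(1,2), of "\<lambda>q. n \<bullet> q"])
      show "n \<bullet> partial_deriv i X y = 0" if "y \<in> U" for y i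
        using tangent[OF X(1) that, of i] n3 by (simp add: inner_n)
    qed (rule bounded_linear_inner_right)
  qed
  then obtain c where c: "\<And>p. p \<in> S \<Longrightarrow> n \<bullet> p = c"
    by (auto simp: constant_on_def)
  let ?P = "{p. n \<bullet> p = c}"
  have "vertical_plane ?P"
    unfolding vertical_plane_def using n12
    by (intro exI[of _ "n $ 1"] exI[of _ "n $ 2"] exI[of _ c]) (simp add: inner_n)
  moreover have "openin (top_of_set ?P) S"
  \<comment> \<open>Openness is checked pointwise: each point lies in a chart image that is open in
    the plane and contained in \<open>S\<close>.\<close>
  proof (subst openin_subopen, rule ballI)
    fix p assume "p \<in> S"
    then obtain U X where X: "local_param S U X" "p \<in> X ` U"
      using S(1) unfolding surface_def by blast
    have "n \<noteq> 0" using n12 by auto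
    then have "openin (top_of_set ?P) (X ` U)"
      using c by (intro local_param_openin_hyperplane[OF X(1)]) auto
    with X local_paramD(4)[OF X(1)]
    show "\<exists>T. openin (top_of_set ?P) T \<and> p \<in> T \<and> T \<subseteq> S" by blast
  qed
  ultimately show ?thesis by blast
qed

section \<open>Inverse matrices, the trace formula and the Levi-Civita connection\<close>

section \<open>Mean curvature in the Heisenberg group\<close>

text \<open>\<open>matrix_inv\<close> is a choice among two-sided inverses; for square matrices over
  a field a right inverse is two-sided, hence unique.\<close>

lemma matrix_inv_eqI:
  fixes A B :: "'a::field^'n^'n"
  assumes "A ** B = mat 1"
  shows "matrix_inv A = B"
  unfolding matrix_inv_def
proof (rule some_equality)
  show "A ** B = mat 1 \<and> B ** A = mat 1"
    using assms matrix_left_right_inverse by blast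
  fix C assume "A ** C = mat 1 \<and> C ** A = mat 1"
  then show "C = B"
    using assms by (metis matrix_mul_assoc matrix_mul_lid matrix_mul_rid)
qed

text \<open>The inverse is the adjugate divided by the determinant. With the two fundamental forms
  for \<open>A\<close> and \<open>B\<close> this is the classical
  \<open>(G L - 2 F M + E N) / (E G - F\<^sup>2)\<close>.\<close>

lemma trace_matrix_inv_mult_2:
  fixes A B :: "real^2^2"
  assumes "det A \<noteq> 0"
  shows "trace (matrix_inv A ** B)
    = (A$2$2 * B$1$1 - A$1$2 * B$2$1 - A$2$1 * B$1$2 + A$1$1 * B$2$2) / det A"
proof -
  define d where "d = det A"
  have d: "d \<noteq> 0" "A$1$1 * A$2$2 = d + A$1$2 * A$2$1"
    using assms by (simp_all add: d_def det_2)
  define C :: "real^2^2" where "C = vector [vector [A$2$2 / d, - A$1$2 / d],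
    vector [- A$2$1 / d, A$1$1 / d]]"
  have "A ** C = mat 1"
    using d by (simp add: C_def matrix_matrix_mult_def mat_def vec_eq_iff forall_2 sum_2 field_simps)
  then have "matrix_inv A = C"
    by (rule matrix_inv_eqI)
  then show ?thesis
    by (simp add: C_def trace_def matrix_matrix_mult_def sum_2 add_divide_distrib diff_divide_distrib flip: d_def)
qed

text \<open>The inverse metric is the sum of the squares of the orthonormal frame
  \<open>(1, 0, -y/2)\<close>, \<open>(0, 1, x/2)\<close>, \<open>(0, 0, 1)\<close>.\<close>

lemma matrix_inv_heis_metric:
  "matrix_inv (metric_matrix heis_metric p) = vector [vector [1, 0, - p$2 / 2], vector [0, 1, p$1 / 2],
     vector [- p$2 / 2, p$1 / 2, 1 + ((p$1)\<^sup>2 + (p$2)\<^sup>2) / 4]]"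
  by (rule matrix_inv_eqI)
     (simp add: metric_matrix_def heis_metric_def heis_form_def axis_def matrix_matrix_mult_def mat_def
        vec_eq_iff forall_3 sum_3 field_simps power2_eq_square)

text \<open>Only the product of the two values of \<open>heis_form\<close> varies with the point, so
  this is the product rule.\<close>

lemma partial_deriv_heis_metric:
  "partial_deriv l (\<lambda>q. metric_matrix heis_metric q $ i $ j) p =
    (axis l 1 $ 2 * axis i 1 $ 1 - axis l 1 $ 1 * axis i 1 $ 2) / 2 * heis_form p (axis j 1)
    + heis_form p (axis i 1) * ((axis l 1 $ 2 * axis j 1 $ 1 - axis l 1 $ 1 * axis j 1 $ 2) / 2)"
proof -
  have nth: "((\<lambda>q. q $ k) has_derivative (\<lambda>h. h $ k)) (at p)" for k :: 3
    by (rule bounded_linear_imp_has_derivative) (rule bounded_linear_vec_nth)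
  have form: "((\<lambda>q. heis_form q v) has_derivative (\<lambda>h. (h$2 * v$1 - h$1 * v$2) / 2)) (at p)" for v
    unfolding heis_form_def by (rule derivative_eq_intros nth refl)+ (auto simp: field_simps)
  have "((\<lambda>q. metric_matrix heis_metric q $ i $ j) has_derivative
    (\<lambda>h. heis_form p (axis i 1) * ((h$2 * axis j 1 $ 1 - h$1 * axis j 1 $ 2) / 2)
      + (h$2 * axis i 1 $ 1 - h$1 * axis i 1 $ 2) / 2 * heis_form p (axis j 1))) (at p)"
    unfolding metric_matrix_def heis_metric_def vec_lambda_beta
    by (rule derivative_eq_intros form refl)+ simp
  from partial_deriv_eqI[OF this] show ?thesis by simp
qed

text \<open>Contracting with \<open>v\<close> and \<open>w\<close> collapses the Christoffel symbols
  into values of \<open>heis_form\<close>. The first two components are the ones that pair with a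
  normal on which \<open>heis_form\<close> vanishes.\<close>

lemma heis_connection_1:
  "(\<Sum>a\<in>UNIV. \<Sum>b\<in>UNIV. christoffel heis_metric p 1 a b * v$a * w$b)
    = (v$2 * heis_form p w + w$2 * heis_form p v) / 2"
  unfolding christoffel_def matrix_inv_heis_metric partial_deriv_heis_metric
  by (simp add: sum_3 axis_def heis_form_def field_simps)

lemma heis_connection_2:
  "(\<Sum>a\<in>UNIV. \<Sum>b\<in>UNIV. christoffel heis_metric p 2 a b * v$a * w$b)
    = - ((v$1 * heis_form p w + w$1 * heis_form p v) / 2)"
  unfolding christoffel_def matrix_inv_heis_metric partial_deriv_heis_metric
  by (simp add: sum_3 axis_def heis_form_def field_simps)

section \<open>From a vertical plane to minimality and a constant Gauss map\<close>

section \<open>Vertical planes\<close>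

lemma vertical_plane_normalized:
  assumes "vertical_plane P"
  obtains a b c where "a\<^sup>2 + b\<^sup>2 = 1" "P = {p. a * p$1 + b * p$2 = c}"
proof -
  obtain a b c where ab: "(a, b) \<noteq> (0, 0)" and P: "P = {p. a * p$1 + b * p$2 = c}"
    using assms unfolding vertical_plane_def by blast
  define d where "d = sqrt (a\<^sup>2 + b\<^sup>2)"
  have "a\<^sup>2 + b\<^sup>2 > 0"
    using ab by (auto simp: sum_power2_gt_zero_iff)
  then have d: "d > 0" "d\<^sup>2 = a\<^sup>2 + b\<^sup>2"
    by (auto simp: d_def)
  have "(a / d)\<^sup>2 + (b / d)\<^sup>2 = (a\<^sup>2 + b\<^sup>2) / d\<^sup>2"
    by (simp add: power_divide add_divide_distrib)
  then have "(a / d)\<^sup>2 + (b / d)\<^sup>2 = 1"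
    using d(1) by (simp flip: d(2))
  moreover have "P = {p. a / d * p$1 + b / d * p$2 = c / d}"
    using d(1) by (simp add: P flip: add_divide_distrib)
  ultimately show ?thesis by (rule that)
qed

context
  fixes a b c :: real and P :: "(real^3) set"
  assumes unit: "a\<^sup>2 + b\<^sup>2 = 1" and P: "P = {p. a * p$1 + b * p$2 = c}"
begin

text \<open>A global affine chart: \<open>(a c, b c, 0)\<close> is the foot of the Euclidean
  perpendicular from the origin, and the two directions are the horizontal one in the plane and the
  \<open>z\<close>-axis.\<close>

lemma plane_param:
  fixes L :: "real^2 \<Rightarrow> real^3"
  defines "L \<equiv> \<lambda>u. u$1 *\<^sub>R vector [- b, a, 0] + u$2 *\<^sub>R axis 3 1"
  shows "local_param P UNIV (\<lambda>u. L u + vector [a * c, b * c, 0])" (is "local_param P UNIV ?X")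
    and "range (\<lambda>u. L u + vector [a * c, b * c, 0]) = P"
    and "frechet_derivative (\<lambda>u. L u + vector [a * c, b * c, 0]) (at u) = L"
proof -
  have unit': "a * (a * t) + b * (b * t) = t" for t
    using unit by (simp add: power2_eq_square flip: mult.assoc distrib_right)
  have "linear L"
    by (rule linearI) (auto simp: L_def algebra_simps)
  then have bl: "bounded_linear L"
    by (simp add: linear_conv_bounded_linear)
  then have "(?X has_derivative L) (at u)" for u
    by (auto intro!: derivative_eq_intros bounded_linear_imp_has_derivative)
  then show F: "frechet_derivative ?X (at u) = L" for u
    using frechet_derivative_at by metis
  \<comment> \<open>Recovers the parameters as the Euclidean product with \<open>(-b, a, 0)\<close>,
    to which the base point contributes nothing, and the height.\<close>
  define Y :: "real^3 \<Rightarrow> real^2"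
    where "Y = (\<lambda>p. (a * p$2 - b * p$1) *\<^sub>R axis 1 1 + p$3 *\<^sub>R axis 2 1)"
  have YX: "Y (?X u) = u" for u
    by (simp add: Y_def L_def vec_eq_iff forall_2 axis_def algebra_simps unit')
  have XP: "?X u \<in> P" for u
    by (simp add: P L_def axis_def algebra_simps unit')
  have XY: "?X (Y p) = p" if "p \<in> P" for p
    using that by (auto simp: P Y_def L_def vec_eq_iff forall_3 axis_def algebra_simps unit')
  show range: "range ?X = P"
  proof (intro subset_antisym subsetI)
    fix p assume "p \<in> P"
    then have "p = ?X (Y p)" by (simp only: XY)
    then show "p \<in> range ?X" by (rule range_eqI)
  qed (use XP in blast)
  have "homeomorphism UNIV P ?X Y"
  proof (rule homeomorphismI)
    show "continuous_on UNIV ?X" "continuous_on P Y"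
      unfolding L_def Y_def by (intro continuous_intros)+
  qed (use YX XP XY in auto)
  moreover have "inj L"
  proof (rule injI)
    fix u v assume "L u = L v"
    then have "Y (?X u) = Y (?X v)" by simp
    then show "u = v" by (simp only: YX)
  qed
  ultimately show "local_param P UNIV ?X"
    unfolding local_param_def range F using smooth_on_affine[OF bl] by auto
qed

lemma surface_plane: "surface P"
  unfolding surface_def using plane_param(1,2) by blast

lemma connected_plane: "connected P"
proof -
  have "P = {p. (vector [a, b, 0] :: real^3) \<bullet> p = c}"
    by (simp add: P inner_vec_def sum_3)
  then show ?thesis
    by (simp add: convex_connected convex_hyperplane)
qed

text \<open>The equation of the plane is differentiated along the chart. Differentiating once more
  will remove the second-order terms from the second fundamental form.\<close>

lemma partial_deriv_tangent_plane:
  assumes "local_param P U X" "u \<in> U"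
  shows "a * partial_deriv i X u $ 1 + b * partial_deriv i X u $ 2 = 0"
proof (rule derivative_zero_of_zero_on_open)
  note U = local_paramD[OF assms(1)]
  show "open U" "u \<in> U" by fact+
  show "a * X y $ 1 + b * X y $ 2 - c = 0" if "y \<in> U" for y
    using U(4) that by (auto simp: P)
  have "((\<lambda>t. X (u + t *\<^sub>R axis i 1) $ k) has_real_derivative partial_deriv i X u $ k) (at 0)" for k
    by (intro has_real_derivative_along_axis smooth_on_differentiable[OF U(2,1) assms(2)])
  note D = this
  show "((\<lambda>t. a * X (u + t *\<^sub>R axis i 1) $ 1 + b * X (u + t *\<^sub>R axis i 1) $ 2 - c) has_real_derivative
      a * partial_deriv i X u $ 1 + b * partial_deriv i X u $ 2) (at 0)"
    by (rule derivative_eq_intros D refl)+ simp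
qed

lemma second_partial_deriv_tangent_plane:
  assumes "local_param P U X" "u \<in> U"
  shows "a * partial_deriv i (partial_deriv j X) u $ 1 + b * partial_deriv i (partial_deriv j X) u $ 2 = 0"
proof (rule derivative_zero_of_zero_on_open)
  note U = local_paramD[OF assms(1)]
  show "open U" "u \<in> U" by fact+
  show "a * partial_deriv j X y $ 1 + b * partial_deriv j X y $ 2 = 0" if "y \<in> U" for y
    using partial_deriv_tangent_plane[OF assms(1) that] .
  have "((\<lambda>t. partial_deriv j X (u + t *\<^sub>R axis i 1) $ k) has_real_derivative
      partial_deriv i (partial_deriv j X) u $ k) (at 0)" for k
    by (intro has_real_derivative_along_axis smooth_on_differentiable[OF U(2,1) assms(2)])
  note D = this
  show "((\<lambda>t. a * partial_deriv j X (u + t *\<^sub>R axis i 1) $ 1 + b * partial_deriv j X (u + t *\<^sub>R axis i 1) $ 2)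
    has_real_derivative
      a * partial_deriv i (partial_deriv j X) u $ 1 + b * partial_deriv i (partial_deriv j X) u $ 2) (at 0)"
    by (rule derivative_eq_intros D refl)+ simp
qed

lemma unit_normal_field_plane_exists: "\<exists>\<eta>. unit_normal_field heis_metric P \<eta>"
proof
  \<comment> \<open>This is \<open>a E\<^sub>1 + b E\<^sub>2\<close> written in coordinates.\<close>
  define \<eta> :: "real^3 \<Rightarrow> real^3"
    where "\<eta> = (\<lambda>p. vector [a, b, 0] + ((p$1 * b - p$2 * a) / 2) *\<^sub>R axis 3 1)"
  have \<eta>: "\<eta> p $ 1 = a" "\<eta> p $ 2 = b" "heis_form p (\<eta> p) = 0" for p
    by (auto simp: \<eta>_def heis_form_def axis_def field_simps)
  show "unit_normal_field heis_metric P \<eta>"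
    unfolding unit_normal_field_def
  proof (intro conjI ballI)
    show "continuous_on P \<eta>"
      unfolding \<eta>_def by (intro continuous_intros) simp
    show "heis_metric p (\<eta> p) (\<eta> p) = 1" for p
      using unit by (simp add: heis_metric_def \<eta> power2_eq_square)
    show "heis_metric p (\<eta> p) v = 0" if v: "v \<in> tangent_space P p" for p v
    proof -
      obtain U X u w where X: "local_param P U X" "u \<in> U" "v = frechet_derivative X (at u) w"
        using v unfolding tangent_space_def by blast
      have "a * v$1 + b * v$2
        = w$1 * (a * partial_deriv 1 X u $ 1 + b * partial_deriv 1 X u $ 2)
        + w$2 * (a * partial_deriv 2 X u $ 1 + b * partial_deriv 2 X u $ 2)"
        using frechet_derivative_local_param[OF X(1,2)] by (simp add: X(3) algebra_simps)
      then show ?thesis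
        using partial_deriv_tangent_plane[OF X(1,2)] by (simp add: heis_metric_def \<eta>)
    qed
  qed
qed

text \<open>At each point the normal is \<open>a E\<^sub>1 + b E\<^sub>2\<close> up to a sign
  \<open>s p\<close>. The sign is continuous with values in a finite set, hence constant on the
  connected plane.\<close>

lemma unit_normal_field_plane:
  assumes "unit_normal_field heis_metric P \<eta>"
  obtains \<sigma> where "\<And>p. p \<in> P \<Longrightarrow> \<eta> p $ 1 = \<sigma> * a"
    "\<And>p. p \<in> P \<Longrightarrow> \<eta> p $ 2 = \<sigma> * b" "\<And>p. p \<in> P \<Longrightarrow> heis_form p (\<eta> p) = 0"
proof -
  define s where "s = (\<lambda>p. a * \<eta> p $ 1 + b * \<eta> p $ 2)"
  have normal: "heis_form p (\<eta> p) = 0 \<and> \<eta> p $ 1 = s p * a \<and> \<eta> p $ 2 = s p * b \<and> (s p)\<^sup>2 = 1"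
    if p: "p \<in> P" for p
  proof -
    obtain u :: "real^2" where u: "p = u$1 *\<^sub>R vector [- b, a, 0] + u$2 *\<^sub>R axis 3 1 + vector [a * c, b * c, 0]"
      using p plane_param(2) by blast
    have "frechet_derivative (\<lambda>u. u$1 *\<^sub>R vector [- b, a, 0] + u$2 *\<^sub>R axis 3 1 + vector [a * c, b * c, 0])
        (at u) w \<in> tangent_space P p" for w
      unfolding tangent_space_def using plane_param(1) u by blast
    then have "w$1 *\<^sub>R vector [- b, a, 0] + w$2 *\<^sub>R axis 3 1 \<in> tangent_space P p" for w :: "real^2"
      by (simp only: plane_param(3))
    then have orth: "heis_metric p (\<eta> p) (w$1 *\<^sub>R vector [- b, a, 0] + w$2 *\<^sub>R axis 3 1) = 0" for w :: "real^2"
      using assms p by (simp add: unit_normal_field_def)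
    have form: "heis_form p (\<eta> p) = 0"
    proof -
      \<comment> \<open>The parameter \<open>axis 2 1\<close> selects the vertical tangent vector;
        \<open>axis 1 1\<close> further down selects the horizontal direction of the plane.\<close>
      have "heis_metric p (\<eta> p) (axis 3 1) = 0"
        using orth[of "axis 2 1"] by (simp add: axis_def)
      moreover have "axis (3::3) 1 $ 1 = (0::real)" "axis (3::3) 1 $ 2 = (0::real)" "heis_form p (axis 3 1) = 1"
        by (simp_all add: heis_form_def axis_def)
      ultimately show ?thesis by (simp add: heis_metric_def)
    qed
    then have e: "a * \<eta> p $ 2 = b * \<eta> p $ 1"
      using orth[of "axis 1 1"] by (simp add: heis_metric_def axis_def algebra_simps)
    have n: "(\<eta> p $ 1)\<^sup>2 + (\<eta> p $ 2)\<^sup>2 = 1"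
    proof -
      have "heis_metric p (\<eta> p) (\<eta> p) = 1"
        using assms p by (simp add: unit_normal_field_def)
      with form show ?thesis by (simp add: heis_metric_def power2_eq_square)
    qed
    have "\<eta> p $ 1 = s p * a" "\<eta> p $ 2 = s p * b" "(s p)\<^sup>2 = 1"
      unfolding s_def using e n unit by algebra+
    with form show ?thesis by simp
  qed
  have "continuous_on P s"
    using assms unfolding s_def unit_normal_field_def
    by (intro continuous_intros) auto
  moreover have "s ` P \<subseteq> {1, -1}"
    using normal by (auto simp: power2_eq_1_iff)
  ultimately have "s constant_on P"
    using continuous_finite_range_constant[OF connected_plane] finite_subset by blast
  then obtain \<sigma> where "\<And>p. p \<in> P \<Longrightarrow> s p = \<sigma>"
    by (auto simp: constant_on_def)
  with normal show ?thesis by (intro that[of \<sigma>]) auto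
qed

lemma gauss_map_plane_constant:
  assumes "unit_normal_field heis_metric P \<eta>"
  shows "gauss_map \<eta> constant_on P"
proof -
  obtain \<sigma> where "\<And>p. p \<in> P \<Longrightarrow> \<eta> p $ 1 = \<sigma> * a"
    "\<And>p. p \<in> P \<Longrightarrow> \<eta> p $ 2 = \<sigma> * b" "\<And>p. p \<in> P \<Longrightarrow> heis_form p (\<eta> p) = 0"
    using unit_normal_field_plane[OF assms] by metis
  then have "gauss_map \<eta> p = vector [\<sigma> * a, \<sigma> * b, 0]" if "p \<in> P" for p
    using that by (simp add: gauss_map_eq)
  then show ?thesis by (auto simp: constant_on_def)
qed

text \<open>Below, \<open>s i\<close> and \<open>w i\<close> are the components of \<open>\<partial>\<^sub>i X\<close> along \<open>T\<close> and \<open>E\<^sub>3\<close>.\<close>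

lemma minimal_plane:
  assumes "unit_normal_field heis_metric P \<eta>"
  shows "minimal heis_metric P \<eta>"
  unfolding minimal_def
proof (intro allI impI ballI)
  fix U X u assume X: "local_param P U X" "u \<in> U"
  obtain \<sigma> where \<eta>: "\<And>p. p \<in> P \<Longrightarrow> \<eta> p $ 1 = \<sigma> * a"
    "\<And>p. p \<in> P \<Longrightarrow> \<eta> p $ 2 = \<sigma> * b" "\<And>p. p \<in> P \<Longrightarrow> heis_form p (\<eta> p) = 0"
    using unit_normal_field_plane[OF assms] by metis
  define V where "V = (\<lambda>i. partial_deriv i X u)"
  define s where "s = (\<lambda>i. a * V i $ 2 - b * V i $ 1)"
  define w where "w = (\<lambda>i. heis_form (X u) (V i))"
  have Xu: "X u \<in> P" using local_paramD(4)[OF X(1)] X(2) by blast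
  \<comment> \<open>Tangency to the plane makes the horizontal part a multiple of
    \<open>(-b, a)\<close>.\<close>
  have V: "V i $ 1 = - b * s i" "V i $ 2 = a * s i" for i
    using partial_deriv_tangent_plane[OF X, of i] unit unfolding s_def V_def by algebra+
  have I: "first_form heis_metric X u $ i $ j = s i * s j + w i * w j" for i j
  proof -
    have "first_form heis_metric X u $ i $ j = V i $ 1 * V j $ 1 + V i $ 2 * V j $ 2 + w i * w j"
      by (simp add: first_form_def heis_metric_def V_def w_def)
    also have "\<dots> = (a\<^sup>2 + b\<^sup>2) * (s i * s j) + w i * w j"
      by (simp add: V algebra_simps power2_eq_square)
    finally show ?thesis by (simp add: unit)
  qed
  have II: "second_form heis_metric \<eta> X u $ i $ j = \<sigma> / 2 * (s i * w j + s j * w i)" for i j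
  proof -
    let ?W = "partial_deriv i (partial_deriv j X) u"
    have "second_form heis_metric \<eta> X u $ i $ j
      = \<sigma> * (a * ?W $ 1 + b * ?W $ 2)
        + \<sigma> / 2 * (a * (V i $ 2 * w j + V j $ 2 * w i) - b * (V i $ 1 * w j + V j $ 1 * w i))"
    proof -
      \<comment> \<open>The third coordinate enters the metric only through
        \<open>heis_form\<close>, where it is multiplied by the vanishing \<open>heis_form\<close>
        of the normal.\<close>
      have cov: "covariant_deriv heis_metric X i (partial_deriv j X) u $ 1
          = ?W $ 1 + (V i $ 2 * w j + V j $ 2 * w i) / 2"
        "covariant_deriv heis_metric X i (partial_deriv j X) u $ 2
          = ?W $ 2 - (V i $ 1 * w j + V j $ 1 * w i) / 2"
        by (simp_all add: covariant_deriv_def heis_connection_1 heis_connection_2 V_def w_def)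
      show ?thesis
        by (simp add: second_form_def heis_metric_def \<eta>[OF Xu] cov) (simp add: field_simps)
    qed
    also have "\<dots> = \<sigma> / 2 * (a * (V i $ 2 * w j + V j $ 2 * w i) - b * (V i $ 1 * w j + V j $ 1 * w i))"
      using second_partial_deriv_tangent_plane[OF X] by simp
    also have "\<dots> = \<sigma> / 2 * ((a\<^sup>2 + b\<^sup>2) * (s i * w j + s j * w i))"
      by (simp add: V algebra_simps power2_eq_square)
    finally show ?thesis by (simp add: unit)
  qed
  \<comment> \<open>The matrix with rows \<open>(s i, w i)\<close> is invertible because the chart
    is an immersion; the square of its determinant is the determinant of the first form.\<close>
  have "s 1 * w 2 \<noteq> s 2 * w 1"
  proof
    assume eq: "s 1 * w 2 = s 2 * w 1"
    have indep: "r = 0 \<and> t = 0" if "r * s 1 + t * s 2 = 0" "r * w 1 + t * w 2 = 0" for r t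
    proof -
      have "r * V 1 $ 1 + t * V 2 $ 1 = - b * (r * s 1 + t * s 2)"
        "r * V 1 $ 2 + t * V 2 $ 2 = a * (r * s 1 + t * s 2)"
        by (simp_all add: V algebra_simps)
      then have 12: "r * V 1 $ 1 + t * V 2 $ 1 = 0" "r * V 1 $ 2 + t * V 2 $ 2 = 0"
        using that(1) by simp_all
      have "r * V 1 $ 3 + t * V 2 $ 3 = (r * w 1 + t * w 2)
        - X u $ 2 / 2 * (r * V 1 $ 1 + t * V 2 $ 1) + X u $ 1 / 2 * (r * V 1 $ 2 + t * V 2 $ 2)"
        by (simp add: w_def heis_form_def field_simps)
      then have "r * V 1 $ 3 + t * V 2 $ 3 = 0"
        using 12 that(2) by simp
      with 12 have "r *\<^sub>R V 1 + t *\<^sub>R V 2 = 0"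
        by (simp add: vec_eq_iff forall_3)
      then show ?thesis
        using partial_derivs_independent[OF X] by (simp add: V_def)
    qed
    \<comment> \<open>The coefficients \<open>s 2\<close> and \<open>- s 1\<close> solve the first
      equation identically and the second by \<open>eq\<close>; \<open>w 2\<close> and
      \<open>- w 1\<close> solve them the other way round.\<close>
    have "s 2 = 0 \<and> - s 1 = 0"
      using eq by (intro indep) (auto simp: algebra_simps)
    moreover have "w 2 = 0 \<and> - w 1 = 0"
      using eq by (intro indep) (auto simp: algebra_simps)
    ultimately show False
      using indep[of 1 0] by simp
  qed
  moreover have "det (first_form heis_metric X u) = (s 1 * w 2 - s 2 * w 1)\<^sup>2"
    by (simp add: det_2 I power2_eq_square algebra_simps)
  ultimately have "det (first_form heis_metric X u) \<noteq> 0"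
    by simp
  \<comment> \<open>With \<open>A\<close> the matrix of rows \<open>(s i, w i)\<close>, the first
    form is \<open>A A\<^sup>T\<close> and the second is \<open>A B A\<^sup>T\<close>, where
    \<open>B\<close> has zero diagonal and off-diagonal entries \<open>\<sigma> / 2\<close>. The
    trace is that of \<open>B\<close>, and the numerator cancels term by term.\<close>
  then show "mean_curvature heis_metric \<eta> X u = 0"
    unfolding mean_curvature_def by (simp add: trace_matrix_inv_mult_2 I II field_simps)
qed

end

theorem theorem5p4:
  shows "(\<forall>P. vertical_plane P \<longrightarrow>
            surface P \<and> connected P \<and> (\<exists>\<eta>. unit_normal_field heis_metric P \<eta>) \<and>
            (\<forall>\<eta>. unit_normal_field heis_metric P \<eta> \<longrightarrow>
                 minimal heis_metric P \<eta> \<and> gauss_map \<eta> constant_on P)) \<and>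
         (\<forall>S \<eta>. surface S \<and> connected S \<and> unit_normal_field heis_metric S \<eta> \<and>
            minimal heis_metric S \<eta> \<and> gauss_map \<eta> constant_on S \<longrightarrow>
            (\<exists>P. vertical_plane P \<and> openin (top_of_set P) S))"
proof (rule conjI; intro allI impI)
  fix P assume "vertical_plane P"
  then obtain a b c where "a\<^sup>2 + b\<^sup>2 = 1" "P = {p. a * p$1 + b * p$2 = c}"
    by (rule vertical_plane_normalized)
  note plane = this
  show "surface P \<and> connected P \<and> (\<exists>\<eta>. unit_normal_field heis_metric P \<eta>) \<and>
      (\<forall>\<eta>. unit_normal_field heis_metric P \<eta> \<longrightarrow>
        minimal heis_metric P \<eta> \<and> gauss_map \<eta> constant_on P)"
    using surface_plane[OF plane] connected_plane[OF plane] unit_normal_field_plane_exists[OF plane]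
      minimal_plane[OF plane] gauss_map_plane_constant[OF plane] by blast
qed (use constant_gauss_map_vertical_plane in blast)

end
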